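(* Let $\Theta$ be a set, $g_0,g_1,\dots,g_m:\Theta\to\mathbb{R}$ functions, $\epsilon\in\mathbb{R}$, and $\theta^{(1)},\dots,\theta^{(T)}\in\Theta$ a sequence of $T$ candidate solutions. Define $\vec g_0,\vec g_1,\dots,\vec g_m\in\mathbb{R}^T$ by $(\vec g_i)_t=g_i(\theta^{(t)})$ for $i\in\{0,1,\dots,m\}$, and consider the linear program $$\min_{p\in\Delta^T}\ \langle p,\vec g_0\rangle\quad\text{s.t.}\quad\forall i\in\{1,\dots,m\}:\ \langle p,\vec g_i\rangle\le\epsilon .$$ Then every vertex $p^*$ of the feasible region (in particular, every optimal vertex) has at most $m^*+1\le m+1$ nonzero elements, where $m^*$ is the number of indices $i\in\{1,\dots,m\}$ whose constraint $\langle p^*,\vec g_i\rangle\le\epsilon$ is active, i.e. holds with equality.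
   Context: $\Delta^T:=\{p\in\mathbb{R}^T:p_t\ge0\ \forall t,\ \sum_{t=1}^Tp_t=1\}$. A vertex of a polytope is an extreme point of it. *)

theory Defs
  imports "HOL-Analysis.Analysis"
begin

text \<open>Vectors in \<open>\<real>\<^sup>T\<close> are indexed by a finite type \<open>'t\<close>, so that \<open>T = CARD('t)\<close>.\<close>

definition prob_simplex :: "(real ^ 't) set" where
  "prob_simplex = {p. (\<forall>t. 0 \<le> p $ t) \<and> (\<Sum>t\<in>UNIV. p $ t) = 1}"

definition candidate_vec :: "(nat \<Rightarrow> 'a \<Rightarrow> real) \<Rightarrow> ('t \<Rightarrow> 'a) \<Rightarrow> nat \<Rightarrow> real ^ 't" where
  "candidate_vec g \<theta> i = (\<chi> t. g i (\<theta> t))"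

definition feasible_region ::
  "(nat \<Rightarrow> 'a \<Rightarrow> real) \<Rightarrow> nat \<Rightarrow> real \<Rightarrow> ('t \<Rightarrow> 'a) \<Rightarrow> (real ^ 't) set" where
  "feasible_region g m \<epsilon> \<theta> =
     {p \<in> prob_simplex. \<forall>i\<in>{1..m}. p \<bullet> candidate_vec g \<theta> i \<le> \<epsilon>}"

definition lp_optimal ::
  "(nat \<Rightarrow> 'a \<Rightarrow> real) \<Rightarrow> nat \<Rightarrow> real \<Rightarrow> ('t \<Rightarrow> 'a) \<Rightarrow> real ^ 't \<Rightarrow> bool" where
  "lp_optimal g m \<epsilon> \<theta> p \<longleftrightarrow>
     p \<in> feasible_region g m \<epsilon> \<theta> \<and>
     (\<forall>q\<in>feasible_region g m \<epsilon> \<theta>. p \<bullet> candidate_vec g \<theta> 0 \<le> q \<bullet> candidate_vec g \<theta> 0)"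

definition num_active ::
  "(nat \<Rightarrow> 'a \<Rightarrow> real) \<Rightarrow> nat \<Rightarrow> real \<Rightarrow> ('t \<Rightarrow> 'a) \<Rightarrow> real ^ 't \<Rightarrow> nat" where
  "num_active g m \<epsilon> \<theta> p = card {i \<in> {1..m}. p \<bullet> candidate_vec g \<theta> i = \<epsilon>}"

end

theory Submission
  imports Defs
begin

text \<open>If the support of a feasible \<open>p\<close> exceeded the number of active constraints by more than one,
  some nonzero direction \<open>d\<close> would vanish off the support, have coordinate sum zero and be orthogonal
  to all active constraint vectors. Inactive constraints and positive coordinates are stable under
  small moves, so \<open>p\<close> would be the midpoint of the feasible points \<open>p + e d\<close> and \<open>p - e d\<close>.\<close>

text \<open>Two properties that hold eventually as \<open>e\<close> tends to 0 from the right hold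
  together for some \<open>e > 0\<close>, so one step size serves both directions. Since
  \<open>d\<close> is nonzero, the two endpoints differ and their midpoint \<open>p\<close> lies in
  an open segment of \<open>S\<close>.\<close>

lemma not_extreme_point_if_two_sided:
  fixes p d :: "'a::real_normed_vector"
  assumes "eventually (\<lambda>e. p + e *\<^sub>R d \<in> S) (at_right 0)"
    and "eventually (\<lambda>e. p - e *\<^sub>R d \<in> S) (at_right 0)"
    and "d \<noteq> 0"
  shows "\<not> p extreme_point_of S"
proof -
  have "eventually (\<lambda>e::real. 0 < e \<and> p + e *\<^sub>R d \<in> S \<and> p - e *\<^sub>R d \<in> S) (at_right 0)"
    using assms(1,2) eventually_at_right_less[of "0::real"] by eventually_elim auto
  then obtain e :: real where e: "0 < e" "p + e *\<^sub>R d \<in> S" "p - e *\<^sub>R d \<in> S"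
    using eventually_happens'[OF trivial_limit_at_right_real] by blast
  have "p + e *\<^sub>R d \<noteq> p - e *\<^sub>R d"
  proof
    assume "p + e *\<^sub>R d = p - e *\<^sub>R d"
    then have "(2 * e) *\<^sub>R d = 0"
      by (simp add: scaleR_2 eq_diff_eq add.assoc flip: scaleR_scaleR)
    then show False using e(1) assms(3) by simp
  qed
  moreover have "midpoint (p + e *\<^sub>R d) (p - e *\<^sub>R d) = p"
    by (simp add: midpoint_def flip: scaleR_2)
  ultimately have "p \<in> open_segment (p + e *\<^sub>R d) (p - e *\<^sub>R d)"
    using midpoint_in_open_segment by metis
  with e show ?thesis by (auto simp: extreme_point_of_def)
qed

text \<open>Dimension count: vanishing at \<open>t\<close> means being orthogonal to
  \<open>axis t 1\<close>, so all requirements on \<open>d\<close> are orthogonality to at most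
  \<open>card A + card (- S)\<close> vectors. That is fewer than the dimension, so their span is a
  proper subspace.\<close>

lemma exists_direction_orthogonal_within_support:
  fixes A :: "(real ^ 't::finite) set"
  assumes "finite A" and "card A < card S"
  obtains d :: "real ^ 't" where "d \<noteq> 0" "\<And>t. t \<notin> S \<Longrightarrow> d $ t = 0" "\<And>a. a \<in> A \<Longrightarrow> d \<bullet> a = 0"
proof -
  let ?B = "A \<union> (\<lambda>t. axis t 1) ` (- S) :: (real ^ 't) set"
  have "dim ?B \<le> card ?B"
    using assms(1) by (intro dim_le_card') simp
  also have "\<dots> \<le> card A + card (- S)"
    using card_Un_le[of A] card_image_le[of "- S" "\<lambda>t. axis t (1::real)"]
    by (meson add_left_mono finite order_trans)
  also have "\<dots> < card S + card (- S)"
    using assms(2) by simp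
  also have "\<dots> = DIM(real ^ 't)"
    using card_Un_disjoint[of S "- S"] by simp
  finally obtain d where d: "d \<noteq> 0" "\<And>y. y \<in> span ?B \<Longrightarrow> orthogonal d y"
    using orthogonal_to_subspace_exists by blast
  have *: "d \<bullet> y = 0" if "y \<in> ?B" for y
    using d(2)[OF span_base[OF that]] by (simp add: orthogonal_def)
  show thesis
  proof (rule that[OF d(1)])
    show "d $ t = 0" if "t \<notin> S" for t
      using *[of "axis t 1"] that by (simp add: inner_axis)
    show "d \<bullet> a = 0" if "a \<in> A" for a
      using * that by simp
  qed
qed

lemma eventually_feasible_in_direction:
  fixes p d :: "real ^ 't::finite"
  assumes p: "p \<in> feasible_region g m \<epsilon> \<theta>"
    and supp: "\<And>t. p $ t = 0 \<Longrightarrow> d $ t = 0"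
    and sum0: "(\<Sum>t\<in>UNIV. d $ t) = 0"
    and active: "\<And>i. i \<in> {1..m} \<Longrightarrow> p \<bullet> candidate_vec g \<theta> i = \<epsilon> \<Longrightarrow> d \<bullet> candidate_vec g \<theta> i = 0"
  shows "eventually (\<lambda>e. p + e *\<^sub>R d \<in> feasible_region g m \<epsilon> \<theta>) (at_right 0)"
proof -
  \<comment> \<open>This limit settles every slack constraint below: an inequality strict at
    \<open>p\<close> persists near \<open>p\<close>. Tight constraints are constant along
    \<open>d\<close>.\<close>
  have lim: "((\<lambda>e. p + e *\<^sub>R d) \<longlongrightarrow> p) (at_right 0)"
    using tendsto_add[OF tendsto_const[of p]
        tendsto_scaleR[OF tendsto_ident_at[of 0 "{0<..}"] tendsto_const[of d]]]
    by simp
  have "\<forall>\<^sub>F e in at_right 0. 0 \<le> (p + e *\<^sub>R d) $ t" for t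
  proof (cases "p $ t = 0")
    case True
    then show ?thesis by (simp add: supp)
  next
    case False
    then have "0 < p $ t"
      using p by (simp add: feasible_region_def prob_simplex_def order_less_le)
    from order_tendstoD(1)[OF tendsto_vec_nth[OF lim] this] show ?thesis
      by (rule eventually_mono) simp
  qed
  \<comment> \<open>The index type is finite, so the thresholds for the single coordinates have a
    common positive lower bound.\<close>
  then have nonneg: "\<forall>\<^sub>F e in at_right 0. \<forall>t. 0 \<le> (p + e *\<^sub>R d) $ t"
    by (simp only: eventually_all_finite)
  have "\<forall>\<^sub>F e in at_right 0. (p + e *\<^sub>R d) \<bullet> candidate_vec g \<theta> i \<le> \<epsilon>" if "i \<in> {1..m}" for i
  proof (cases "p \<bullet> candidate_vec g \<theta> i = \<epsilon>")
    case True
    then show ?thesis by (simp add: inner_add_left active[OF that])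
  next
    case False
    then have "p \<bullet> candidate_vec g \<theta> i < \<epsilon>"
      using p that by (simp add: feasible_region_def order_less_le)
    from order_tendstoD(2)[OF tendsto_inner[OF lim tendsto_const] this] show ?thesis
      by (rule eventually_mono) simp
  qed
  then have "\<forall>\<^sub>F e in at_right 0. \<forall>i\<in>{1..m}. (p + e *\<^sub>R d) \<bullet> candidate_vec g \<theta> i \<le> \<epsilon>"
    by (intro eventually_ball_finite) auto
  with nonneg show ?thesis
  proof eventually_elim
    case (elim e)
    have "(\<Sum>t\<in>UNIV. (p + e *\<^sub>R d) $ t) = 1"
      using p sum0
      by (simp add: feasible_region_def prob_simplex_def sum.distrib flip: sum_distrib_left)
    with elim show ?case
      by (simp add: feasible_region_def prob_simplex_def)
  qed
qed

lemma extreme_point_feasible_region_card_support: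
  fixes p :: "real ^ 't::finite"
  assumes "p extreme_point_of feasible_region g m \<epsilon> \<theta>"
  shows "card {t. p $ t \<noteq> 0} \<le> num_active g m \<epsilon> \<theta> p + 1"
proof (rule ccontr)
  let ?I = "{i \<in> {1..m}. p \<bullet> candidate_vec g \<theta> i = \<epsilon>}"
  \<comment> \<open>Here \<open>1\<close> is the all-ones vector: orthogonality to it says that the
    coordinates of \<open>d\<close> sum to zero. It accounts for the \<open>+ 1\<close> in the
    bound.\<close>
  let ?A = "insert 1 (candidate_vec g \<theta> ` ?I)"
  assume "\<not> ?thesis"
  \<comment> \<open>Only an inequality, as different active indices may give the same vector and one
    of these may be \<open>1\<close>.\<close>
  moreover have "card ?A \<le> num_active g m \<epsilon> \<theta> p + 1"
    using card_insert_le_m1[of "card ?I + 1" "candidate_vec g \<theta> ` ?I" 1]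
      card_image_le[of ?I "candidate_vec g \<theta>"]
    by (simp add: num_active_def)
  ultimately have "card ?A < card {t. p $ t \<noteq> 0}"
    by linarith
  then obtain d where d: "d \<noteq> 0" "\<And>t. t \<notin> {t. p $ t \<noteq> 0} \<Longrightarrow> d $ t = 0"
    "\<And>a. a \<in> ?A \<Longrightarrow> d \<bullet> a = 0"
    using exists_direction_orthogonal_within_support[of ?A "{t. p $ t \<noteq> 0}"] by auto
  have p: "p \<in> feasible_region g m \<epsilon> \<theta>"
    using assms by (simp add: extreme_point_of_def)
  have sum0: "(\<Sum>t\<in>UNIV. d $ t) = 0"
    using d(3)[of 1] by (simp add: inner_vec_def)
  have "eventually (\<lambda>e. p + e *\<^sub>R d \<in> feasible_region g m \<epsilon> \<theta>) (at_right 0)"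
    using d sum0 by (intro eventually_feasible_in_direction[OF p]) auto
  \<comment> \<open>The conditions on \<open>d\<close> are linear and homogeneous, hence shared by
    \<open>- d\<close>.\<close>
  moreover have "eventually (\<lambda>e. p + e *\<^sub>R (- d) \<in> feasible_region g m \<epsilon> \<theta>) (at_right 0)"
    using d sum0 by (intro eventually_feasible_in_direction[OF p]) (auto simp: sum_negf)
  ultimately show False
    using not_extreme_point_if_two_sided[OF _ _ d(1)] assms by simp
qed

lemma num_active_le: "num_active g m \<epsilon> \<theta> p \<le> m"
proof -
  have "card {i \<in> {1..m}. p \<bullet> candidate_vec g \<theta> i = \<epsilon>} \<le> card {1..m}"
    by (rule card_mono) auto
  then show ?thesis by (simp add: num_active_def)
qed

theorem lemma3:
  fixes \<Theta> :: "'a set"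
    and g :: "nat \<Rightarrow> 'a \<Rightarrow> real"
    and m :: nat
    and \<epsilon> :: real
    and \<theta> :: "'t::finite \<Rightarrow> 'a"
  assumes "\<And>t. \<theta> t \<in> \<Theta>"
  shows "(\<forall>p. p extreme_point_of feasible_region g m \<epsilon> \<theta> \<longrightarrow>
            card {t. p $ t \<noteq> 0} \<le> num_active g m \<epsilon> \<theta> p + 1 \<and>
            num_active g m \<epsilon> \<theta> p + 1 \<le> m + 1) \<and>
         (\<forall>p. p extreme_point_of feasible_region g m \<epsilon> \<theta> \<and> lp_optimal g m \<epsilon> \<theta> p \<longrightarrow>
            card {t. p $ t \<noteq> 0} \<le> num_active g m \<epsilon> \<theta> p + 1 \<and>
            num_active g m \<epsilon> \<theta> p + 1 \<le> m + 1)"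
  using extreme_point_feasible_region_card_support num_active_le by (metis add_le_mono1)

end
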